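(* Let $\dot{\bar x}=\bar f(\bar x)$, $\bar x\in\mathbb{R}^{n(p+1)}$, be the Polynomial Chaos (PC) expansion of order $p$ of the stochastic system $\dot x(t,\xi)=f(x(t,\xi),a(\xi))$, and assume that the stochastic system is accurately represented by this truncated PC expansion. If the PC expanded system has an equilibrium point $\bar x_{\mathrm{EP}}\in\mathbb{R}^{n(p+1)}$, then the stochastic system has the equilibrium set given by uncertainty-dependent elements $$\mathcal{I}=\{x\in\mathbb{R}^n \mid x\in x_{\mathrm{EP}}(\xi)\},\qquad x_{\mathrm{EP}}(\xi)\sim\lambda(\bar M_{1..P}(\bar x_{\mathrm{EP}})),$$ that is, $\mathcal{I}$ consists of the realizations of an uncertainty-dependent equilibrium point $x_{\mathrm{EP}}(\xi)$, the random variable represented by the PC coefficients $\bar x_{\mathrm{EP}}$, whose moments are those determined by $\bar x_{\mathrm{EP}}$.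
   Context: Setting. $(\Theta,\mathcal F,\mu)$ is a probability space and $\xi$ (the stochastic germ) is a real random variable with law $\mu$ and finite second moment. The stochastic system is $\dot x(t,\xi)=f(x(t,\xi),a(\xi))$, where $x\in\mathbb{R}^n$ is the random state, $a(\xi)\in\mathbb{R}^m$ is a square-integrable random variable and $f:\mathbb{R}^n\times\mathbb{R}^m\to\mathbb{R}^n$ is polynomial. The system may have an uncertainty-dependent equilibrium point $x_{\mathrm{EP}}(\xi)$, i.e. a random variable with $f(x_{\mathrm{EP}}(\xi),a(\xi))=0$ (for $\mu$-almost every $\xi$). The associated equilibrium set $\mathcal I\subset\mathbb{R}^n$ is the set given by the evaluation of $x_{\mathrm{EP}}(\xi)$ for each realization of the uncertainty. Polynomial Chaos. $\{\Phi_i\}_{i\in\mathbb{N}_0}$ is a system of polynomials with $\deg\Phi_i=i$, $\Phi_i\in L^2(\mu)$, $\Phi_0=1$, $\langle\Phi_i,\Phi_j\rangle=\int\Phi_i\Phi_j\,d\mu=\gamma_i\delta_{ij}$, $\gamma_i>0$. The order-$p$ PC expansion of a square-integrable random vector $y(\xi)$ is $y(\xi)=\sum_{i=0}^p\bar y_i\Phi_i(\xi)$ with vector coefficients $\bar y_i=\langle y,\Phi_i\rangle/\gamma_i$. The stacked vector $\bar y=(\bar y_0,\dots,\bar y_p)$ is said to represent $y(\xi)$. The PC expansion of the stochastic system is the deterministic ODE $\dot{\bar x}=\bar f(\bar x)$ on $\mathbb{R}^{n(p+1)}$ obtained by substituting the order-$p$ expansions of $x$ and $a$ and projecting on each basis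 polynomial: $\bar f_q(\bar x)=\gamma_q^{-1}\langle f(\sum_i\bar x_i\Phi_i,\sum_i\bar a_i\Phi_i),\Phi_q\rangle$, $q=0,\dots,p$. Accuracy assumption. "The stochastic system is accurately represented by its truncated PC expansion" means that the solutions correspond exactly: if $\bar x(t)$ solves $\dot{\bar x}=\bar f(\bar x)$, then $x(t,\xi)=\sum_{i=0}^p\bar x_i(t)\Phi_i(\xi)$ is (almost surely in $\xi$) the solution of the stochastic system with initial state $\sum_{i=0}^p\bar x_i(0)\Phi_i(\xi)$. Moments. $\lambda(M_{1..P})$ denotes a probability distribution with given moments up to order $P$, $1\le P<\infty$, and $\sim$ means "has distribution". For a coefficient vector $\bar x$, $\bar M_{1..P}(\bar x)$ denotes the moments determined by $\bar x$, the $P$-th one being $\sum_{i_1,\dots,i_P=0}^p\bar x_{i_1}\cdots\bar x_{i_P}\,\langle\Phi_{i_1}\cdots\Phi_{i_{P-1}},\Phi_{i_P}\rangle$ (products read componentwise, i.e. the $P$-th raw moment of each component of $\sum_i\bar x_i\Phi_i(\xi)$). In particular the mean is $\bar x_0$. *)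

theory Defs
  imports "HOL-Probability.Probability" "HOL-Computational_Algebra.Polynomial"
begin

text \<open>
  Throughout, \<open>\<mu>\<close> is the law of the stochastic germ, a measure on the reals, and a random
  variable \<open>y(\<xi>)\<close> is given by the function \<open>y\<close> of the value of the germ. A stacked coefficient
  vector in \<open>\<real>^{n(p+1)}\<close> is a function \<open>nat \<Rightarrow> real ^ 'n\<close> of which only the values at
  \<open>0, \<dots>, p\<close> are ever used.
\<close>

definition sq_integrable_rv :: "real measure \<Rightarrow> (real \<Rightarrow> 'b::euclidean_space) \<Rightarrow> bool" where
  "sq_integrable_rv \<mu> y \<longleftrightarrow> y \<in> borel_measurable borel \<and> integrable \<mu> (\<lambda>s. (norm (y s))\<^sup>2)"

definition pc_inner :: "real measure \<Rightarrow> (real \<Rightarrow> 'b::euclidean_space) \<Rightarrow> (real \<Rightarrow> real) \<Rightarrow> 'b" where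
  "pc_inner \<mu> u v = (LINT s|\<mu>. v s *\<^sub>R u s)"

definition pc_basis :: "real measure \<Rightarrow> (nat \<Rightarrow> real poly) \<Rightarrow> (nat \<Rightarrow> real) \<Rightarrow> bool" where
  "pc_basis \<mu> \<Phi> \<gamma> \<longleftrightarrow>
     (\<forall>i. degree (\<Phi> i) = i) \<and>
     (\<forall>i. sq_integrable_rv \<mu> (poly (\<Phi> i))) \<and>
     \<Phi> 0 = 1 \<and>
     (\<forall>i j. pc_inner \<mu> (poly (\<Phi> i)) (poly (\<Phi> j)) = (if i = j then \<gamma> i else 0)) \<and>
     (\<forall>i. \<gamma> i > 0)"

definition pc_coeff ::
  "real measure \<Rightarrow> (nat \<Rightarrow> real poly) \<Rightarrow> (nat \<Rightarrow> real) \<Rightarrow> (real \<Rightarrow> 'b::euclidean_space) \<Rightarrow> nat \<Rightarrow> 'b" where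
  "pc_coeff \<mu> \<Phi> \<gamma> y i = pc_inner \<mu> y (poly (\<Phi> i)) /\<^sub>R \<gamma> i"

definition pc_series ::
  "(nat \<Rightarrow> real poly) \<Rightarrow> nat \<Rightarrow> (nat \<Rightarrow> 'b::euclidean_space) \<Rightarrow> real \<Rightarrow> 'b" where
  "pc_series \<Phi> p c s = (\<Sum>i\<le>p. poly (\<Phi> i) s *\<^sub>R c i)"

definition pc_represents ::
  "real measure \<Rightarrow> (nat \<Rightarrow> real poly) \<Rightarrow> (nat \<Rightarrow> real) \<Rightarrow> nat \<Rightarrow>
   (nat \<Rightarrow> 'b::euclidean_space) \<Rightarrow> (real \<Rightarrow> 'b) \<Rightarrow> bool" where
  "pc_represents \<mu> \<Phi> \<gamma> p c y \<longleftrightarrow>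
     sq_integrable_rv \<mu> y \<and>
     (\<forall>i\<le>p. c i = pc_coeff \<mu> \<Phi> \<gamma> y i) \<and>
     (AE s in \<mu>. y s = pc_series \<Phi> p c s)"

definition pc_rhs ::
  "real measure \<Rightarrow> (nat \<Rightarrow> real poly) \<Rightarrow> (nat \<Rightarrow> real) \<Rightarrow> nat \<Rightarrow>
   (real ^ 'n \<Rightarrow> real ^ 'm \<Rightarrow> real ^ 'n) \<Rightarrow> (real \<Rightarrow> real ^ 'm) \<Rightarrow>
   (nat \<Rightarrow> real ^ 'n) \<Rightarrow> nat \<Rightarrow> real ^ 'n" where
  "pc_rhs \<mu> \<Phi> \<gamma> p f a c q =
     pc_inner \<mu> (\<lambda>s. f (pc_series \<Phi> p c s) (pc_series \<Phi> p (pc_coeff \<mu> \<Phi> \<gamma> a) s)) (poly (\<Phi> q)) /\<^sub>R \<gamma> q"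

definition pc_equilibrium ::
  "real measure \<Rightarrow> (nat \<Rightarrow> real poly) \<Rightarrow> (nat \<Rightarrow> real) \<Rightarrow> nat \<Rightarrow>
   (real ^ 'n \<Rightarrow> real ^ 'm \<Rightarrow> real ^ 'n) \<Rightarrow> (real \<Rightarrow> real ^ 'm) \<Rightarrow> (nat \<Rightarrow> real ^ 'n) \<Rightarrow> bool" where
  "pc_equilibrium \<mu> \<Phi> \<gamma> p f a c \<longleftrightarrow> (\<forall>q\<le>p. pc_rhs \<mu> \<Phi> \<gamma> p f a c q = 0)"

definition pc_solution ::
  "real measure \<Rightarrow> (nat \<Rightarrow> real poly) \<Rightarrow> (nat \<Rightarrow> real) \<Rightarrow> nat \<Rightarrow>
   (real ^ 'n \<Rightarrow> real ^ 'm \<Rightarrow> real ^ 'n) \<Rightarrow> (real \<Rightarrow> real ^ 'm) \<Rightarrow>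
   real set \<Rightarrow> (real \<Rightarrow> nat \<Rightarrow> real ^ 'n) \<Rightarrow> bool" where
  "pc_solution \<mu> \<Phi> \<gamma> p f a J c \<longleftrightarrow>
     (\<forall>t\<in>J. \<forall>q\<le>p. ((\<lambda>r. c r q) has_vector_derivative pc_rhs \<mu> \<Phi> \<gamma> p f a (c t) q) (at t within J))"

text \<open>
  Solutions are pathwise: one null set serves all times. The parameter enters as \<open>a\<close> itself,
  not as its truncated expansion.
\<close>

definition stoch_solution ::
  "real measure \<Rightarrow> (real ^ 'n \<Rightarrow> real ^ 'm \<Rightarrow> real ^ 'n) \<Rightarrow> (real \<Rightarrow> real ^ 'm) \<Rightarrow>
   real set \<Rightarrow> (real \<Rightarrow> real ^ 'n) \<Rightarrow> (real \<Rightarrow> real \<Rightarrow> real ^ 'n) \<Rightarrow> bool" where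
  "stoch_solution \<mu> f a J x0 x \<longleftrightarrow>
     (AE s in \<mu>. x 0 s = x0 s \<and>
        (\<forall>t\<in>J. ((\<lambda>r. x r s) has_vector_derivative f (x t s) (a s)) (at t within J)))"

text \<open>
  Polynomial systems may escape in finite time, so solutions on arbitrary time intervals starting
  at 0 are considered. The initial value problem for polynomial \<open>f\<close> has at most one solution, so
  being a solution is the same as being the solution.
\<close>

definition accurately_represented ::
  "real measure \<Rightarrow> (nat \<Rightarrow> real poly) \<Rightarrow> (nat \<Rightarrow> real) \<Rightarrow> nat \<Rightarrow>
   (real ^ 'n \<Rightarrow> real ^ 'm \<Rightarrow> real ^ 'n) \<Rightarrow> (real \<Rightarrow> real ^ 'm) \<Rightarrow> bool" where
  "accurately_represented \<mu> \<Phi> \<gamma> p f a \<longleftrightarrow>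
     (\<forall>J c. is_interval J \<and> 0 \<in> J \<and> J \<subseteq> {0..} \<and> pc_solution \<mu> \<Phi> \<gamma> p f a J c \<longrightarrow>
        stoch_solution \<mu> f a J (pc_series \<Phi> p (c 0)) (\<lambda>t. pc_series \<Phi> p (c t)))"

definition uncertain_equilibrium ::
  "real measure \<Rightarrow> (real ^ 'n \<Rightarrow> real ^ 'm \<Rightarrow> real ^ 'n) \<Rightarrow> (real \<Rightarrow> real ^ 'm) \<Rightarrow>
   (real \<Rightarrow> real ^ 'n) \<Rightarrow> bool" where
  "uncertain_equilibrium \<mu> f a y \<longleftrightarrow>
     y \<in> borel_measurable borel \<and> (AE s in \<mu>. f (y s) (a s) = 0)"

text \<open>
  \<open>I\<close> is an equilibrium set of the stochastic system: the evaluations of some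
  uncertainty-dependent equilibrium point at all realizations of the germ \<open>\<xi>\<close> on \<open>M\<close>.
\<close>

definition has_equilibrium_set ::
  "'w measure \<Rightarrow> ('w \<Rightarrow> real) \<Rightarrow> (real ^ 'n \<Rightarrow> real ^ 'm \<Rightarrow> real ^ 'n) \<Rightarrow> (real \<Rightarrow> real ^ 'm) \<Rightarrow>
   (real ^ 'n) set \<Rightarrow> bool" where
  "has_equilibrium_set M \<xi> f a I \<longleftrightarrow>
     (\<exists>y. uncertain_equilibrium (distr M borel \<xi>) f a y \<and> I = {x. \<exists>\<omega>\<in>space M. x = y (\<xi> \<omega>)})"

text \<open>
  The multi-indices \<open>(i\<^sub>1, \<dots>, i\<^sub>k)\<close> with entries in \<open>{0..p}\<close> are the extensional functions
  on \<open>{1..k}\<close>; products of coefficient vectors are componentwise.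
\<close>

definition pc_moment ::
  "real measure \<Rightarrow> (nat \<Rightarrow> real poly) \<Rightarrow> nat \<Rightarrow> (nat \<Rightarrow> real ^ 'n) \<Rightarrow> nat \<Rightarrow> real ^ 'n" where
  "pc_moment \<mu> \<Phi> p c k =
     (\<chi> j. \<Sum>i\<in>{1..k} \<rightarrow>\<^sub>E {0..p}. (\<Prod>l\<in>{1..k}. c (i l) $ j) *
        pc_inner \<mu> (\<lambda>s. \<Prod>l\<in>{1..<k}. poly (\<Phi> (i l)) s) (poly (\<Phi> (i k))))"

text \<open>
  Finitely many moments do not determine a distribution, so \<open>\<lambda>(M\<^sub>1, \<dots>, M\<^sub>P)\<close> is rendered as
  the set of all distributions with these (componentwise, raw) moments.
\<close>

definition moment_distributions :: "nat \<Rightarrow> (nat \<Rightarrow> real ^ 'n) \<Rightarrow> (real ^ 'n) measure set" where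
  "moment_distributions P m =
     {N. prob_space N \<and> sets N = sets borel \<and>
         (\<forall>k\<in>{1..P}. \<forall>j. integrable N (\<lambda>x. (x $ j) ^ k) \<and> (LINT x|N. (x $ j) ^ k) = m k $ j)}"

end

theory Submission
  imports Defs
begin

text \<open>
  A constant coefficient path at an equilibrium solves the expanded system, so by accuracy the
  constant path \<open>x\<^sub>E\<^sub>P(\<xi>)\<close> almost surely solves the stochastic system, whose right-hand side therefore
  vanishes there. Every polynomial is a combination of the \<open>\<Phi>\<^sub>i\<close>, hence square integrable; so all
  moments of \<open>x\<^sub>E\<^sub>P\<close> are finite, and expanding the powers of the series gives the moment formula.
\<close>

lemma borel_measurable_poly [measurable]: "poly (q :: real poly) \<in> borel_measurable borel"
  by (intro borel_measurable_continuous_onI continuous_intros)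

lemma borel_measurable_pc_series [measurable]: "pc_series \<Phi> p c \<in> borel_measurable borel"
  unfolding pc_series_def by measurable

lemma pc_series_nth:
  "pc_series \<Phi> p c s $ j = poly (\<Sum>i\<le>p. smult (c i $ j) (\<Phi> i)) s"
  by (simp add: pc_series_def poly_sum mult.commute)

text \<open>
  Induction on the degree: subtracting a multiple of \<open>\<Phi>\<^sub>n\<close> removes the leading term.
\<close>

lemma pc_basis_integrable_poly_square:
  assumes basis: "pc_basis \<mu> \<Phi> \<gamma>" and sets: "sets \<mu> = sets borel"
  shows "integrable \<mu> (\<lambda>s. (poly q s)\<^sup>2)"
proof (induction "degree q" arbitrary: q rule: less_induct)
  case less
  have [measurable_cong]: "sets \<mu> = sets borel" by (fact sets)
  define n where "n = degree q"
  define c where "c = lead_coeff q / lead_coeff (\<Phi> n)"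
  define r where "r = q - smult c (\<Phi> n)"
  have deg: "degree (\<Phi> i) = i" and int: "integrable \<mu> (\<lambda>s. (poly (\<Phi> i) s)\<^sup>2)" for i
    using basis by (auto simp: pc_basis_def sq_integrable_rv_def)
  \<comment> \<open>At \<open>n = 0\<close> the degree condition alone would allow the zero
    polynomial; positivity of \<open>\<gamma> n\<close> excludes it for all \<open>n\<close> at
    once.\<close>
  have "\<Phi> n \<noteq> 0"
  proof
    assume "\<Phi> n = 0"
    moreover have "(LINT s|\<mu>. poly (\<Phi> n) s * poly (\<Phi> n) s) > 0"
      using basis by (simp add: pc_basis_def pc_inner_def)
    ultimately show False by simp
  qed
  \<comment> \<open>The second alternative is the end of the descent: for constant \<open>q\<close>
    the remainder is zero, and its degree 0 is not below \<open>n = 0\<close>.\<close>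
  have "degree r < n \<or> r = 0"
  proof (cases "n = 0")
    case True
    have "degree q = 0" "degree (\<Phi> n) = 0" using True deg by (auto simp: n_def)
    then obtain u v where "q = [:u:]" "\<Phi> n = [:v:]" by (metis degree_eq_zeroE)
    then show ?thesis using \<open>\<Phi> n \<noteq> 0\<close> by (simp add: r_def c_def)
  next
    case False
    have "coeff r n = 0"
      using \<open>\<Phi> n \<noteq> 0\<close> deg[of n] leading_coeff_0_iff[of "\<Phi> n"] by (simp add: r_def c_def n_def)
    moreover have "degree r \<le> n"
      unfolding r_def
      by (intro degree_diff_le) (auto simp: n_def deg intro: order.trans[OF degree_smult_le])
    ultimately show ?thesis
      using False by (metis eq_zero_or_degree_less)
  qed
  then have r: "integrable \<mu> (\<lambda>s. (poly r s)\<^sup>2)"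
    using less by (auto simp: n_def)
  \<comment> \<open>A majorant from
    \<open>(x + y)\<^sup>2 \<le> 2 * x\<^sup>2 + 2 * y\<^sup>2\<close>, which avoids integrating the
    mixed term of the expanded square.\<close>
  have "integrable \<mu> (\<lambda>s. 2 * (poly r s)\<^sup>2 + 2 * c\<^sup>2 * (poly (\<Phi> n) s)\<^sup>2)"
    using r int by auto
  then show ?case
  proof (rule Bochner_Integration.integrable_bound)
    show "(\<lambda>s. (poly q s)\<^sup>2) \<in> borel_measurable \<mu>" by measurable
    show "AE s in \<mu>. norm ((poly q s)\<^sup>2)
        \<le> norm (2 * (poly r s)\<^sup>2 + 2 * c\<^sup>2 * (poly (\<Phi> n) s)\<^sup>2)"
    proof (intro AE_I2)
      fix s
      have "poly q s = poly r s + c * poly (\<Phi> n) s"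
        by (simp add: r_def)
      moreover have "(x + y)\<^sup>2 \<le> 2 * x\<^sup>2 + 2 * y\<^sup>2" for x y :: real
        using zero_le_power2[of "x - y"] by (simp add: power2_sum power2_diff)
      ultimately have "(poly q s)\<^sup>2 \<le> 2 * (poly r s)\<^sup>2 + 2 * (c * poly (\<Phi> n) s)\<^sup>2"
        by simp
      then show "norm ((poly q s)\<^sup>2) \<le> norm (2 * (poly r s)\<^sup>2 + 2 * c\<^sup>2 * (poly (\<Phi> n) s)\<^sup>2)"
        by (simp add: power_mult_distrib)
    qed
  qed
qed

text \<open>On a finite measure space square integrable functions are integrable. Since polynomials
  are closed under products, every integrand below is covered by this fact, without estimates for
  products.\<close>

lemma pc_basis_integrable_poly:
  assumes "pc_basis \<mu> \<Phi> \<gamma>" and sets: "sets \<mu> = sets borel" and "finite_measure \<mu>"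
  shows "integrable \<mu> (poly q)"
proof -
  interpret finite_measure \<mu> by fact
  have [measurable_cong]: "sets \<mu> = sets borel" by (fact sets)
  show ?thesis
    by (rule square_integrable_imp_integrable)
      (use pc_basis_integrable_poly_square[OF assms(1,2)] in measurable)
qed

text \<open>Orthogonality leaves only the term with index \<open>i\<close> of the projected sum, and
  its factor \<open>\<gamma> i\<close> cancels against the normalisation.\<close>

lemma pc_coeff_pc_series:
  assumes basis: "pc_basis \<mu> \<Phi> \<gamma>" and "sets \<mu> = sets borel" and "finite_measure \<mu>" and "i \<le> p"
  shows "pc_coeff \<mu> \<Phi> \<gamma> (pc_series \<Phi> p c) i = c i"
proof -
  have int: "integrable \<mu> (\<lambda>s. poly (\<Phi> i) s * poly (\<Phi> k) s)" for k
    using pc_basis_integrable_poly[OF assms(1-3), of "\<Phi> i * \<Phi> k"] by (simp add: poly_mult[abs_def])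
  have orth: "(LINT s|\<mu>. poly (\<Phi> i) s * poly (\<Phi> k) s) = (if k = i then \<gamma> k else 0)" for k
    using basis by (auto simp: pc_basis_def pc_inner_def)
  have "pc_inner \<mu> (pc_series \<Phi> p c) (poly (\<Phi> i)) =
      (LINT s|\<mu>. (\<Sum>k\<le>p. (poly (\<Phi> i) s * poly (\<Phi> k) s) *\<^sub>R c k))"
    by (simp add: pc_inner_def pc_series_def scaleR_sum_right)
  also have "\<dots> = (\<Sum>k\<le>p. (LINT s|\<mu>. poly (\<Phi> i) s * poly (\<Phi> k) s) *\<^sub>R c k)"
    using int by (subst Bochner_Integration.integral_sum) (auto intro!: sum.cong)
  also have "\<dots> = \<gamma> i *\<^sub>R c i"
    using \<open>i \<le> p\<close> by (simp add: orth if_distrib[of "\<lambda>x. x *\<^sub>R _"] cong: if_cong)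
  finally show ?thesis
    using basis by (auto simp: pc_coeff_def pc_basis_def dest: spec[of _ i])
qed

text \<open>The squared norm of the series is again a polynomial in the germ, by bilinearity of the
  inner product, hence integrable.\<close>

lemma pc_represents_pc_series:
  assumes "pc_basis \<mu> \<Phi> \<gamma>" and "sets \<mu> = sets borel" and "finite_measure \<mu>"
  shows "pc_represents \<mu> \<Phi> \<gamma> p c (pc_series \<Phi> p c)"
proof -
  have "(norm (pc_series \<Phi> p c s))\<^sup>2 = poly (\<Sum>i\<le>p. \<Sum>k\<le>p. smult (c i \<bullet> c k) (\<Phi> i * \<Phi> k)) s" for s
    by (simp add: power2_norm_eq_inner pc_series_def inner_sum_left inner_sum_right poly_sum
        sum_distrib_left algebra_simps inner_commute)
  then have "integrable \<mu> (\<lambda>s. (norm (pc_series \<Phi> p c s))\<^sup>2)"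
    using pc_basis_integrable_poly[OF assms] by presburger
  then show ?thesis
    by (simp add: pc_represents_def sq_integrable_rv_def pc_coeff_pc_series[OF assms])
qed

lemma pc_equilibrium_imp_uncertain_equilibrium:
  assumes acc: "accurately_represented \<mu> \<Phi> \<gamma> p f a" and eq: "pc_equilibrium \<mu> \<Phi> \<gamma> p f a c"
  shows "uncertain_equilibrium \<mu> f a (pc_series \<Phi> p c)"
proof -
  \<comment> \<open>Any nondegenerate interval starting at 0 would serve: derivatives within it at 0
    are unique because 0 is a limit point. Within the single point 0 they would not be.\<close>
  let ?J = "{0..1::real}" and ?y = "pc_series \<Phi> p c"
  have "pc_solution \<mu> \<Phi> \<gamma> p f a ?J (\<lambda>_. c)"
    using eq by (simp add: pc_solution_def pc_equilibrium_def)
  moreover have "is_interval ?J" "0 \<in> ?J" "?J \<subseteq> {0..}"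
    by (auto simp: is_interval_cc)
  ultimately have "stoch_solution \<mu> f a ?J ?y (\<lambda>_. ?y)"
    using acc unfolding accurately_represented_def by blast
  then have "AE s in \<mu>. ((\<lambda>_. ?y s) has_vector_derivative f (?y s) (a s)) (at 0 within ?J)"
    by (auto simp: stoch_solution_def)
  moreover have "f (?y s) (a s) = 0"
    if "((\<lambda>_. ?y s) has_vector_derivative f (?y s) (a s)) (at 0 within ?J)" for s
    using vector_derivative_unique_within[OF _ that has_vector_derivative_const]
    by (simp add: trivial_limit_within)
  ultimately show ?thesis
    by (auto simp: uncertain_equilibrium_def)
qed

text \<open>By distributivity the \<open>k\<close>-th power of a sum is a sum over multi-indices of
  length \<open>k\<close>; each summand is a polynomial in the germ, so integration is
  termwise.\<close>

lemma integral_pc_series_power: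
  assumes "pc_basis \<mu> \<Phi> \<gamma>" and "sets \<mu> = sets borel" and "finite_measure \<mu>" and "k \<ge> 1"
  shows "(LINT s|\<mu>. (pc_series \<Phi> p c s $ j) ^ k) = pc_moment \<mu> \<Phi> p c k $ j"
proof -
  let ?I = "{1..k} \<rightarrow>\<^sub>E {0..p}"
  \<comment> \<open>The moment formula pairs the last basis polynomial with the product of the
    others; \<open>k \<ge> 1\<close> guarantees that there is a last one.\<close>
  have "{1..k} = insert k {1..<k}" using \<open>k \<ge> 1\<close> by auto
  then have split: "(\<Prod>l\<in>{1..k}. h l) = h k * (\<Prod>l\<in>{1..<k}. h l)" for h :: "nat \<Rightarrow> real"
    by simp
  have int: "integrable \<mu> (\<lambda>s. \<Prod>l\<in>{1..k}. poly (\<Phi> (i l)) s)" for i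
    using pc_basis_integrable_poly[OF assms(1-3), of "\<Prod>l\<in>{1..k}. \<Phi> (i l)"]
    by (simp add: poly_prod[abs_def])
  have "(pc_series \<Phi> p c s $ j) ^ k =
      (\<Sum>i\<in>?I. (\<Prod>l\<in>{1..k}. c (i l) $ j) * (\<Prod>l\<in>{1..k}. poly (\<Phi> (i l)) s))" for s
  proof -
    have "(pc_series \<Phi> p c s $ j) ^ k = (\<Prod>l\<in>{1..k}. \<Sum>i\<in>{0..p}. c i $ j * poly (\<Phi> i) s)"
      by (simp add: pc_series_nth poly_sum atLeast0AtMost)
    also have "\<dots> = (\<Sum>i\<in>?I. \<Prod>l\<in>{1..k}. c (i l) $ j * poly (\<Phi> (i l)) s)"
      by (subst prod_sum_PiE) auto
    finally show ?thesis
      by (simp add: prod.distrib)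
  qed
  then have "(LINT s|\<mu>. (pc_series \<Phi> p c s $ j) ^ k) =
      (\<Sum>i\<in>?I. (\<Prod>l\<in>{1..k}. c (i l) $ j) * (LINT s|\<mu>. (\<Prod>l\<in>{1..k}. poly (\<Phi> (i l)) s)))"
    using int by (simp add: Bochner_Integration.integral_sum)
  also have "\<dots> = pc_moment \<mu> \<Phi> p c k $ j"
    unfolding pc_moment_def pc_inner_def by (subst (2) split) simp
  finally show ?thesis .
qed

text \<open>Powers of a component are polynomials in the germ, so moments of every order exist and
  \<open>P\<close> is arbitrary. The change of variables moves them to the law of the
  series.\<close>

lemma distr_pc_series_in_moment_distributions:
  assumes "pc_basis \<mu> \<Phi> \<gamma>" and sets: "sets \<mu> = sets borel" and "prob_space \<mu>"
  shows "distr \<mu> borel (pc_series \<Phi> p c) \<in> moment_distributions P (pc_moment \<mu> \<Phi> p c)"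
proof -
  interpret prob_space \<mu> by fact
  have [measurable_cong]: "sets \<mu> = sets borel" by (fact sets)
  have meas: "pc_series \<Phi> p c \<in> measurable \<mu> borel"
    by measurable
  have "integrable \<mu> (\<lambda>s. (pc_series \<Phi> p c s $ j) ^ k)" for j k
    using pc_basis_integrable_poly[OF assms(1,2) finite_measure_axioms,
        of "(\<Sum>i\<le>p. smult (c i $ j) (\<Phi> i)) ^ k"]
    by (simp add: pc_series_nth poly_power[abs_def])
  then show ?thesis
    using integral_pc_series_power[OF assms(1,2) finite_measure_axioms]
    by (auto simp: moment_distributions_def prob_space_distr[OF meas]
        integrable_distr_eq[OF meas] integral_distr[OF meas])
qed

theorem lemma1:
  fixes M :: "'w measure" and \<xi> :: "'w \<Rightarrow> real" and \<mu> :: "real measure"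
    and \<Phi> :: "nat \<Rightarrow> real poly" and \<gamma> :: "nat \<Rightarrow> real" and p P :: nat
    and f :: "real ^ 'n \<Rightarrow> real ^ 'm \<Rightarrow> real ^ 'n" and a :: "real \<Rightarrow> real ^ 'm"
    and xbarEP :: "nat \<Rightarrow> real ^ 'n"
  assumes "prob_space M"
    and "\<xi> \<in> borel_measurable M"
    and "\<mu> = distr M borel \<xi>"
    and "integrable M (\<lambda>\<omega>. (\<xi> \<omega>)\<^sup>2)"
    and "pc_basis \<mu> \<Phi> \<gamma>"
    and "polynomial_function (\<lambda>(x, b). f x b)"
    and "sq_integrable_rv \<mu> a"
    and "accurately_represented \<mu> \<Phi> \<gamma> p f a"
    and "pc_equilibrium \<mu> \<Phi> \<gamma> p f a xbarEP"
    and "P \<ge> 1"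
  shows "let xEP = pc_series \<Phi> p xbarEP in
      pc_represents \<mu> \<Phi> \<gamma> p xbarEP xEP \<and>
      uncertain_equilibrium \<mu> f a xEP \<and>
      has_equilibrium_set M \<xi> f a {x. \<exists>\<omega>\<in>space M. x = xEP (\<xi> \<omega>)} \<and>
      distr M borel (\<lambda>\<omega>. xEP (\<xi> \<omega>)) \<in> moment_distributions P (pc_moment \<mu> \<Phi> p xbarEP)"
proof -
  let ?x = "pc_series \<Phi> p xbarEP"
  have sets: "sets \<mu> = sets borel"
    using assms(3) by simp
  interpret M: prob_space M by (fact assms(1))
  have prob: "prob_space \<mu>"
    unfolding assms(3) by (rule M.prob_space_distr) (fact assms(2))
  then have fin: "finite_measure \<mu>"
    by (rule prob_space.finite_measure)
  have equi: "uncertain_equilibrium \<mu> f a ?x"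
    using assms(8,9) by (rule pc_equilibrium_imp_uncertain_equilibrium)
  then have "has_equilibrium_set M \<xi> f a {x. \<exists>\<omega>\<in>space M. x = ?x (\<xi> \<omega>)}"
    unfolding has_equilibrium_set_def assms(3) by blast
  \<comment> \<open>The random vector lives on \<open>M\<close>, while the moments were computed
    under the law \<open>\<mu>\<close> of the germ; pushing forward in two steps identifies the
    distributions.\<close>
  moreover have "distr M borel (\<lambda>\<omega>. ?x (\<xi> \<omega>)) = distr \<mu> borel ?x"
    unfolding assms(3) using assms(2) by (subst distr_distr) (auto simp: comp_def)
  ultimately show ?thesis
    using equi
    by (simp add: Let_def pc_represents_pc_series[OF assms(5) sets fin]
        distr_pc_series_in_moment_distributions[OF assms(5) sets prob])
qed

end
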